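(* Let $G$ be a $d$-regular graph on $N$ vertices with $d>0$, and let $-\lambda$ be the smallest eigenvalue of its adjacency matrix. Let $i(G)$ denote the number of stable sets in $G$. Then $$i(G)\le \sum_{i=0}^{\lceil \sigma N\rceil}\binom{N}{i}2^{\alpha N},$$ where $\alpha=\frac{\lambda}{d+\lambda}$ and $\sigma=\frac{\ln(d+1)}{d+\lambda}$.
   Context: Graphs are finite and simple. A stable set in $G$ is a set of vertices no two of which are adjacent (the empty set is a stable set). $\ln$ is the natural logarithm. *)

theory Defs
  imports Complex_Main "Graph_Theory.Graph_Theory" "Jordan_Normal_Form.Char_Poly"
begin

text \<open>
  Finite simple graphs are rendered by the locale \<^locale>\<open>graph\<close>: finite symmetric digraphs
  without loops and without parallel arcs. An edge \<open>uv\<close> is the pair of arcs \<open>(u, v)\<close>, \<open>(v, u)\<close>,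
  so the degree of a vertex is its \<^const>\<open>out_degree\<close>.
\<close>

definition regular_graph :: "nat \<Rightarrow> ('a, 'b) pre_digraph \<Rightarrow> bool" where
  "regular_graph d G \<longleftrightarrow> (\<forall>v\<in>verts G. out_degree G v = d)"

definition stable_set :: "('a, 'b) pre_digraph \<Rightarrow> 'a set \<Rightarrow> bool" where
  "stable_set G S \<longleftrightarrow> S \<subseteq> verts G \<and> (\<forall>u\<in>S. \<forall>v\<in>S. \<not> u \<rightarrow>\<^bsub>G\<^esub> v)"

definition num_stable_sets :: "('a, 'b) pre_digraph \<Rightarrow> nat" where
  "num_stable_sets G = card {S. stable_set G S}"

text \<open>
  Matrices are indexed by natural numbers, so the adjacency matrix is taken with respect to an
  ordering \<open>vs\<close> of the vertices. Changing the ordering conjugates it by a permutation matrix.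
\<close>

definition vertex_ordering :: "('a, 'b) pre_digraph \<Rightarrow> 'a list \<Rightarrow> bool" where
  "vertex_ordering G vs \<longleftrightarrow> distinct vs \<and> set vs = verts G"

definition adjacency_matrix :: "('a, 'b) pre_digraph \<Rightarrow> 'a list \<Rightarrow> real mat" where
  "adjacency_matrix G vs =
     mat (length vs) (length vs) (\<lambda>(i, j). if vs ! i \<rightarrow>\<^bsub>G\<^esub> vs ! j then 1 else 0)"

text \<open>
  Intended for symmetric matrices, all of whose eigenvalues are real.
\<close>

definition smallest_eigenvalue :: "real mat \<Rightarrow> real \<Rightarrow> bool" where
  "smallest_eigenvalue A m \<longleftrightarrow> eigenvalue A m \<and> (\<forall>k. eigenvalue A k \<longrightarrow> m \<le> k)"

end

theory Submission
  imports Defs "HOL-Analysis.Function_Topology"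
begin

text \<open>
  Write \<open>\<beta> = (d + \<lambda>) / N\<close> and \<open>c = \<alpha> N\<close>. The proof rests on two ideas.

  \<^item> \<^emph>\<open>Large vertex sets span many edges.\<close> The smallest eigenvalue \<open>-\<lambda>\<close> bounds the quadratic
    form of the adjacency matrix from below. Evaluating the form on the centred indicator
    \<open>1\<^sub>B - |B| / N\<close> of a vertex set \<open>B\<close> shows that the average degree of the graph induced on \<open>B\<close>
    is at least \<open>\<beta> (|B| - c)\<close> (\<open>average_degree_ge\<close>), so some vertex of \<open>B\<close> has at least
    that many neighbours in \<open>B\<close>.

  \<^item> \<^emph>\<open>Branching on such vertices (the method of Kleitman and Winston).\<close> A stable subset of \<open>B\<close>
    either avoids a chosen vertex \<open>v\<close>, and so lies in \<open>B - {v}\<close>, or contains it, and then its other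
    elements lie in \<open>B - {v} - N(v)\<close>. As long as \<open>|B| > c\<close>, choose \<open>v\<close> of large degree in \<open>B\<close>. The
    second alternative then multiplies the potential \<open>\<beta> (|B| - c) + 1\<close> by at most
    \<open>1 - \<beta> \<le> exp (-\<beta>)\<close>, while the first one does not increase it. The potential starts at
    \<open>\<beta> (N - c) + 1 = d + 1\<close>, so after \<open>k \<ge> ln (d + 1) / \<beta> = \<sigma> N\<close> branches of the second
    kind at most \<open>c\<close> vertices remain, which have at most \<open>2\<^sup>c\<close> subsets. Pascal's rule adds up the
    two branches to the sum of binomial coefficients (\<open>card_stable_subsets_le\<close>).

  The variational principle behind the first idea is proved by compactness: a quadratic form
  attains its minimum on the unit sphere, and a minimiser is an eigenvector
  (\<open>symmetric_form_min_eigenvector\<close>).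
\<close>

section \<open>Quadratic forms and their smallest eigenvalue\<close>

text \<open>
  This is the first-order condition at the zero \<open>x\<close>, a minimum of the form: moving from \<open>x\<close> by \<open>t\<close>
  along a coordinate \<open>v\<close> changes the form by \<open>2 t r + t\<^sup>2 b\<^sub>v\<^sub>v\<close>, where \<open>r\<close> is entry \<open>v\<close> of the image
  of \<open>x\<close>, and this is nonnegative for every \<open>t\<close> only if \<open>r = 0\<close>.
\<close>

lemma nonneg_form_zero_imp_kernel:
  fixes b :: "'a \<Rightarrow> 'a \<Rightarrow> real"
  assumes fin: "finite V" and sym: "\<And>i j. i \<in> V \<Longrightarrow> j \<in> V \<Longrightarrow> b i j = b j i"
    and nonneg: "\<And>f. (\<Sum>i\<in>V. \<Sum>j\<in>V. b i j * f i * f j) \<ge> 0"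
    and zero: "(\<Sum>i\<in>V. \<Sum>j\<in>V. b i j * x i * x j) = 0" and v: "v \<in> V"
  shows "(\<Sum>j\<in>V. b v j * x j) = 0"
proof -
  define e where "e = (\<lambda>i. if i = v then 1 else 0 :: real)"
  define r where "r = (\<Sum>j\<in>V. b v j * x j)"
  have row: "(\<Sum>i\<in>V. \<Sum>j\<in>V. b i j * e i * x j) = r"
  proof -
    have "(\<Sum>i\<in>V. \<Sum>j\<in>V. b i j * e i * x j) = (\<Sum>i\<in>V. if i = v then r else 0)"
      by (intro sum.cong) (auto simp: e_def r_def)
    then show ?thesis using fin v by simp
  qed
  have col: "(\<Sum>i\<in>V. \<Sum>j\<in>V. b i j * x i * e j) = r"
  proof -
    have "(\<Sum>i\<in>V. \<Sum>j\<in>V. b i j * x i * e j) = (\<Sum>i\<in>V. \<Sum>j\<in>V. b j i * x j * e i)"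
      by (rule sum.swap)
    also have "\<dots> = (\<Sum>i\<in>V. \<Sum>j\<in>V. b i j * e i * x j)"
      by (intro sum.cong) (auto simp: sym)
    finally show ?thesis using row by simp
  qed
  have diag: "(\<Sum>i\<in>V. \<Sum>j\<in>V. b i j * e i * e j) = b v v"
  proof -
    have "(\<Sum>i\<in>V. \<Sum>j\<in>V. b i j * e i * e j)
        = (\<Sum>i\<in>V. if i = v then (\<Sum>j\<in>V. if j = v then b v v else 0) else 0)"
      by (intro sum.cong) (auto simp: e_def intro!: sum.cong)
    then show ?thesis using fin v by simp
  qed
  have quad: "2 * t * r + t\<^sup>2 * b v v \<ge> 0" for t
  proof -
    have "(\<Sum>i\<in>V. \<Sum>j\<in>V. b i j * (x i + t * e i) * (x j + t * e j))
        = (\<Sum>i\<in>V. \<Sum>j\<in>V. b i j * x i * x j + t * (b i j * e i * x j)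
            + t * (b i j * x i * e j) + t\<^sup>2 * (b i j * e i * e j))"
      by (simp add: algebra_simps power2_eq_square)
    also have "\<dots> = 0 + t * r + t * r + t\<^sup>2 * b v v"
      by (simp only: sum.distrib sum_distrib_left[symmetric] zero row col diag)
    finally show ?thesis using nonneg[of "\<lambda>i. x i + t * e i"] by (simp add: mult_ac)
  qed
  \<comment> \<open>At \<open>t = - r / c\<close> the linear term outweighs the quadratic one as soon as \<open>2 c > b v v\<close>.\<close>
  define c where "c = \<bar>b v v\<bar> + 1"
  have c: "c > 0" "b v v < 2 * c" by (auto simp: c_def)
  have "0 \<le> c\<^sup>2 * (2 * (- r / c) * r + (- r / c)\<^sup>2 * b v v)"
    using quad[of "- r / c"] by simp
  also have "\<dots> = r\<^sup>2 * (b v v - 2 * c)"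
    using c by (simp add: field_simps power2_eq_square)
  finally have "r\<^sup>2 \<le> 0"
    using c by (simp add: zero_le_mult_iff)
  then show ?thesis by (simp add: r_def)
qed

text \<open>
  Functions on the index set are taken to vanish outside it, so that the unit sphere becomes a
  closed subset of a product of the compact sets \<open>[-1, 1]\<close> and \<open>{0}\<close>.
\<close>

lemma compact_unit_sphere_on:
  fixes V :: "'a set"
  assumes "finite V"
  shows "compact {f :: 'a \<Rightarrow> real. (\<forall>i. i \<notin> V \<longrightarrow> f i = 0) \<and> (\<Sum>i\<in>V. (f i)\<^sup>2) = 1}"
    (is "compact ?S")
proof -
  define C where "C = (\<lambda>i. if i \<in> V then {-1..1::real} else {0})"
  have "compactin (product_topology (\<lambda>i. euclidean) UNIV) (PiE UNIV C)"
    unfolding compactin_PiE by (auto simp: C_def)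
  then have comp: "compact (PiE UNIV C)"
    by (simp only: euclidean_product_topology compactin_euclidean_iff)
  have cont: "continuous_on UNIV (\<lambda>f :: 'a \<Rightarrow> real. \<Sum>i\<in>V. (f i)\<^sup>2)"
    by (intro continuous_intros continuous_on_product_coordinates)
  have "closed ((\<lambda>f :: 'a \<Rightarrow> real. \<Sum>i\<in>V. (f i)\<^sup>2) -` {1})"
    by (rule closed_vimage[OF closed_singleton cont])
  with comp have "compact (PiE UNIV C \<inter> (\<lambda>f. \<Sum>i\<in>V. (f i)\<^sup>2) -` {1})"
    by (rule compact_Int_closed)
  also have "PiE UNIV C \<inter> (\<lambda>f. \<Sum>i\<in>V. (f i)\<^sup>2) -` {1} = ?S"
  proof (intro equalityI subsetI)
    fix f assume f: "f \<in> PiE UNIV C \<inter> (\<lambda>f. \<Sum>i\<in>V. (f i)\<^sup>2) -` {1}"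
    then have "f i \<in> C i" for i by auto
    then have "f i = 0" if "i \<notin> V" for i using that by (metis C_def singletonD)
    then show "f \<in> ?S" using f by auto
  next
    fix f assume f: "f \<in> ?S"
    have "f i \<in> {-1..1}" if "i \<in> V" for i
    proof -
      have "(f i)\<^sup>2 \<le> (\<Sum>i\<in>V. (f i)\<^sup>2)"
        using assms that by (intro member_le_sum) auto
      also have "\<dots> = 1" using f by simp
      finally have "\<bar>f i\<bar> \<le> 1" by (simp add: abs_square_le_1)
      then show ?thesis by auto
    qed
    then show "f \<in> PiE UNIV C \<inter> (\<lambda>f. \<Sum>i\<in>V. (f i)\<^sup>2) -` {1}"
      using f by (auto simp: C_def)
  qed
  finally show ?thesis .
qed

text \<open>
  The eigenvalue is the minimum \<open>m\<close> of the form on the unit sphere, and the eigenvector is a point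
  where it is attained: there the nonnegative form of the matrix \<open>a - m I\<close> vanishes.
\<close>

lemma symmetric_form_min_eigenvector:
  fixes a :: "'a \<Rightarrow> 'a \<Rightarrow> real"
  assumes fin: "finite V" and ne: "V \<noteq> {}"
    and sym: "\<And>i j. i \<in> V \<Longrightarrow> j \<in> V \<Longrightarrow> a i j = a j i"
  obtains x m where "\<exists>i\<in>V. x i \<noteq> 0" "\<And>i. i \<in> V \<Longrightarrow> (\<Sum>j\<in>V. a i j * x j) = m * x i"
    "\<And>f. (\<Sum>i\<in>V. \<Sum>j\<in>V. a i j * f i * f j) \<ge> m * (\<Sum>i\<in>V. (f i)\<^sup>2)"
proof -
  define q where "q = (\<lambda>f :: 'a \<Rightarrow> real. \<Sum>i\<in>V. \<Sum>j\<in>V. a i j * f i * f j)"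
  define S where "S = {f :: 'a \<Rightarrow> real. (\<forall>i. i \<notin> V \<longrightarrow> f i = 0) \<and> (\<Sum>i\<in>V. (f i)\<^sup>2) = 1}"
  have cont: "continuous_on S q"
    unfolding q_def
    by (intro continuous_intros continuous_on_subset[OF continuous_on_product_coordinates subset_UNIV])
  obtain v where v: "v \<in> V" using ne by auto
  have "(\<Sum>i\<in>V. (if i = v then 1 else 0 :: real)\<^sup>2) = (\<Sum>i\<in>V. if i = v then 1 else 0)"
    by (intro sum.cong) auto
  then have "(\<lambda>i. if i = v then 1 else 0) \<in> S"
    using v fin by (auto simp: S_def)
  then obtain x where x: "x \<in> S" and min: "\<And>f. f \<in> S \<Longrightarrow> q x \<le> q f"
    using continuous_attains_inf[OF _ _ cont] compact_unit_sphere_on[OF fin] S_def by blast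
  have lower: "q f \<ge> q x * (\<Sum>i\<in>V. (f i)\<^sup>2)" for f
  proof (cases "(\<Sum>i\<in>V. (f i)\<^sup>2) = 0")
    case True
    then have "\<forall>i\<in>V. f i = 0" using fin by (simp add: sum_nonneg_eq_0_iff)
    then have "q f = 0" by (auto simp: q_def)
    then show ?thesis using True by simp
  next
    case False
    define s where "s = sqrt (\<Sum>i\<in>V. (f i)\<^sup>2)"
    have s2: "s\<^sup>2 = (\<Sum>i\<in>V. (f i)\<^sup>2)" by (simp add: s_def sum_nonneg)
    with False have s0: "s \<noteq> 0" by auto
    define g where "g = (\<lambda>i. if i \<in> V then f i / s else 0)"
    have "(\<Sum>i\<in>V. (g i)\<^sup>2) = (\<Sum>i\<in>V. (f i)\<^sup>2 / s\<^sup>2)"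
      by (intro sum.cong) (auto simp: g_def power_divide)
    also have "\<dots> = 1" using s0 by (simp flip: sum_divide_distrib s2)
    finally have "g \<in> S" by (auto simp: S_def g_def)
    then have "q x \<le> q g" by (rule min)
    also have "q g = (\<Sum>i\<in>V. \<Sum>j\<in>V. a i j * f i * f j / s\<^sup>2)"
      unfolding q_def by (intro sum.cong) (auto simp: g_def power2_eq_square)
    also have "\<dots> = q f / s\<^sup>2" by (simp add: q_def sum_divide_distrib)
    finally have "q x * s\<^sup>2 \<le> q f"
      using s0 by (simp only: pos_le_divide_eq zero_less_power2 not_False_eq_True)
    then show ?thesis by (simp only: s2)
  qed
  define m where "m = q x"
  have lower: "q f \<ge> m * (\<Sum>i\<in>V. (f i)\<^sup>2)" for f
    using lower by (simp add: m_def)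
  define b where "b = (\<lambda>i j. a i j - (if i = j then m else 0))"
  have b_sum: "(\<Sum>j\<in>V. b i j * f j) = (\<Sum>j\<in>V. a i j * f j) - m * f i" if "i \<in> V" for f i
  proof -
    have "(\<Sum>j\<in>V. b i j * f j) = (\<Sum>j\<in>V. a i j * f j - (if i = j then m * f i else 0))"
      by (intro sum.cong refl) (simp add: b_def left_diff_distrib)
    then show ?thesis using fin that by (simp add: sum_subtractf)
  qed
  have b_form: "(\<Sum>i\<in>V. \<Sum>j\<in>V. b i j * f i * f j) = q f - m * (\<Sum>i\<in>V. (f i)\<^sup>2)" for f
  proof -
    have "(\<Sum>i\<in>V. \<Sum>j\<in>V. b i j * f i * f j) = (\<Sum>i\<in>V. f i * (\<Sum>j\<in>V. b i j * f j))"
      by (simp add: sum_distrib_left mult_ac)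
    also have "\<dots> = (\<Sum>i\<in>V. f i * (\<Sum>j\<in>V. a i j * f j) - m * (f i)\<^sup>2)"
      by (intro sum.cong refl) (simp add: b_sum right_diff_distrib power2_eq_square)
    also have "\<dots> = q f - m * (\<Sum>i\<in>V. (f i)\<^sup>2)"
      by (simp add: sum_subtractf sum_distrib_left q_def mult_ac)
    finally show ?thesis .
  qed
  have unit: "(\<Sum>i\<in>V. (x i)\<^sup>2) = 1" using x by (simp add: S_def)
  have "(\<Sum>j\<in>V. b i j * x j) = 0" if "i \<in> V" for i
  proof (rule nonneg_form_zero_imp_kernel[OF fin])
    show "b i j = b j i" if "i \<in> V" "j \<in> V" for i j
      using that sym[of i j] by (auto simp: b_def)
    show "(\<Sum>i\<in>V. \<Sum>j\<in>V. b i j * f i * f j) \<ge> 0" for f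
      using lower[of f] by (simp add: b_form)
    show "(\<Sum>i\<in>V. \<Sum>j\<in>V. b i j * x i * x j) = 0"
      by (simp add: b_form unit m_def)
  qed fact
  then have "(\<Sum>j\<in>V. a i j * x j) = m * x i" if "i \<in> V" for i
    using that b_sum[of i x] by simp
  moreover have "\<exists>i\<in>V. x i \<noteq> 0"
    using unit by (metis (no_types, lifting) power_zero_numeral sum.neutral zero_neq_one)
  ultimately show ?thesis using lower that[of x m] unfolding q_def by blast
qed

lemma adjacency_matrix_eigenvalueI:
  assumes vs: "vertex_ordering G vs" and nz: "\<exists>v\<in>verts G. x v \<noteq> 0"
    and ev: "\<And>u. u \<in> verts G \<Longrightarrow>
      (\<Sum>v\<in>verts G. (if u \<rightarrow>\<^bsub>G\<^esub> v then 1 else 0) * x v) = m * x u"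
  shows "eigenvalue (adjacency_matrix G vs) m"
proof -
  define n where "n = length vs"
  define A where "A = adjacency_matrix G vs"
  define w where "w = vec n (\<lambda>i. x (vs ! i))"
  have dist: "distinct vs" and set: "set vs = verts G"
    using vs by (auto simp: vertex_ordering_def)
  have bij: "bij_betw ((!) vs) {0..<n} (verts G)"
    using bij_betw_nth[OF dist, of "{0..<n}" "verts G"] set
    by (simp add: n_def atLeast0LessThan)
  have dims: "dim_row A = n" "dim_col A = n"
    by (auto simp: A_def adjacency_matrix_def n_def)
  have "A *\<^sub>v w = m \<cdot>\<^sub>v w"
  proof (rule eq_vecI)
    show "dim_vec (A *\<^sub>v w) = dim_vec (m \<cdot>\<^sub>v w)" by (simp add: dims w_def)
    fix i assume "i < dim_vec (m \<cdot>\<^sub>v w)"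
    then have i: "i < n" by (simp add: w_def)
    have "(A *\<^sub>v w) $ i
        = (\<Sum>j\<in>{0..<n}. (if vs ! i \<rightarrow>\<^bsub>G\<^esub> vs ! j then 1 else 0) * x (vs ! j))"
      using i
      by (auto simp: A_def adjacency_matrix_def n_def w_def scalar_prod_def intro!: sum.cong)
    also have "\<dots> = (\<Sum>v\<in>verts G. (if vs ! i \<rightarrow>\<^bsub>G\<^esub> v then 1 else 0) * x v)"
      by (rule sum.reindex_bij_betw[OF bij])
    also have "\<dots> = m * x (vs ! i)"
    proof (rule ev)
      show "vs ! i \<in> verts G" using i nth_mem[of i vs] unfolding set n_def by blast
    qed
    finally show "(A *\<^sub>v w) $ i = (m \<cdot>\<^sub>v w) $ i" using i by (simp add: w_def)
  qed
  moreover have "w \<noteq> 0\<^sub>v n"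
  proof
    assume w0: "w = 0\<^sub>v n"
    have "x (vs ! i) = 0" if "i < n" for i
    proof -
      have "w $ i = 0" using w0 that by simp
      then show ?thesis using that by (simp add: w_def)
    qed
    moreover obtain v where "v \<in> verts G" "x v \<noteq> 0" using nz by auto
    ultimately show False using set unfolding n_def by (metis in_set_conv_nth)
  qed
  ultimately have "eigenvector A w m"
    by (auto simp: eigenvector_def dims w_def)
  then show ?thesis by (auto simp: eigenvalue_def A_def)
qed

section \<open>Edges inside a vertex set of a regular graph\<close>

lemma out_degree_eq_card_neighbours:
  assumes "graph G"
  shows "out_degree G v = card {u \<in> verts G. v \<rightarrow>\<^bsub>G\<^esub> u}"
proof -
  interpret graph G by fact
  have "bij_betw (head G) (out_arcs G v) {u \<in> verts G. v \<rightarrow>\<^bsub>G\<^esub> u}"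
  proof (rule bij_betwI')
    show "(head G e = head G f) = (e = f)" if "e \<in> out_arcs G v" "f \<in> out_arcs G v" for e f
      using that no_multi_arcs[of e f] by (auto simp: arc_to_ends_def)
    show "head G e \<in> {u \<in> verts G. v \<rightarrow>\<^bsub>G\<^esub> u}" if "e \<in> out_arcs G v" for e
      using that by (auto simp: arcs_ends_def arc_to_ends_def)
    show "\<exists>e\<in>out_arcs G v. u = head G e" if "u \<in> {u \<in> verts G. v \<rightarrow>\<^bsub>G\<^esub> u}" for u
      using that by (auto simp: arcs_ends_def arc_to_ends_def)
  qed
  then show ?thesis by (simp add: out_degree_def bij_betw_same_card)
qed

text \<open>
  The sum on the right is the quadratic form of the adjacency matrix at the indicator of \<open>B\<close>. The
  bound compares it with the form at the centred indicator \<open>f = 1\<^sub>B - |B| / N\<close>: by regularity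
  centring lowers the form by exactly \<open>d |B|\<^sup>2 / N\<close>, and \<open>\<parallel>f\<parallel>\<^sup>2 = |B| - |B|\<^sup>2 / N\<close>.
\<close>

lemma average_degree_ge:
  assumes G: "graph G" and reg: "regular_graph d G" and vs: "vertex_ordering G vs"
    and ev: "smallest_eigenvalue (adjacency_matrix G vs) (- lam)" and B: "B \<subseteq> verts G"
    and N: "N = real (card (verts G))" "N > 0"
  shows "real (card B) * ((real d + lam) * real (card B) / N - lam)
    \<le> (\<Sum>v\<in>B. real (card {u \<in> B. v \<rightarrow>\<^bsub>G\<^esub> u}))"
proof -
  interpret graph G by fact
  define V where "V = verts G"
  define a :: "'a \<Rightarrow> 'a \<Rightarrow> real" where "a = (\<lambda>u v. if u \<rightarrow>\<^bsub>G\<^esub> v then 1 else 0)"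
  have fin: "finite V" by (simp add: V_def)
  have ne: "V \<noteq> {}" using N by (auto simp: V_def)
  have sym: "a u v = a v u" for u v
    using sym_arcs by (auto simp: a_def symmetric_def sym_def)
  obtain x m where x: "\<exists>i\<in>V. x i \<noteq> 0" "\<And>i. i \<in> V \<Longrightarrow> (\<Sum>j\<in>V. a i j * x j) = m * x i"
    and m: "\<And>f. (\<Sum>i\<in>V. \<Sum>j\<in>V. a i j * f i * f j) \<ge> m * (\<Sum>i\<in>V. (f i)\<^sup>2)"
    by (rule symmetric_form_min_eigenvector[OF fin ne, of a]) (auto intro: sym)
  have "eigenvalue (adjacency_matrix G vs) m"
    using adjacency_matrix_eigenvalueI[OF vs, of x m] x by (simp add: V_def a_def)
  then have lam: "- lam \<le> m" using ev by (auto simp: smallest_eigenvalue_def)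
  define s where "s = real (card B)"
  define p where "p = s / N"
  define h where "h = (\<lambda>u. if u \<in> B then 1 else 0 :: real)"
  have row: "(\<Sum>v\<in>V. a u v) = d" if "u \<in> V" for u
  proof -
    have "(\<Sum>v\<in>V. a u v) = real (card {v \<in> V. u \<rightarrow>\<^bsub>G\<^esub> v})"
      using fin by (simp add: a_def sum.If_cases Int_def)
    then show ?thesis
      using that reg out_degree_eq_card_neighbours[OF G, of u] by (simp add: regular_graph_def V_def)
  qed
  have BV: "V \<inter> B = B" using B by (auto simp: V_def)
  have sum_h: "(\<Sum>u\<in>V. h u) = s"
    using fin BV by (simp add: h_def s_def sum.If_cases)
  have sum_ah: "(\<Sum>u\<in>V. \<Sum>v\<in>V. a u v * h u) = d * s"
  proof -
    have "(\<Sum>u\<in>V. \<Sum>v\<in>V. a u v * h u) = (\<Sum>u\<in>V. d * h u)"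
      by (intro sum.cong) (auto simp: row simp flip: sum_distrib_right)
    then show ?thesis by (simp add: sum_h flip: sum_distrib_left)
  qed
  have sum_ah': "(\<Sum>u\<in>V. \<Sum>v\<in>V. a u v * h v) = d * s"
  proof -
    have "(\<Sum>u\<in>V. \<Sum>v\<in>V. a u v * h v) = (\<Sum>u\<in>V. \<Sum>v\<in>V. a v u * h u)"
      by (rule sum.swap)
    then show ?thesis using sum_ah by (simp add: sym)
  qed
  have sum_a: "(\<Sum>u\<in>V. \<Sum>v\<in>V. a u v) = d * N"
    using row N by (simp add: V_def)
  have sum_hah: "(\<Sum>u\<in>V. \<Sum>v\<in>V. a u v * h u * h v) = (\<Sum>v\<in>B. real (card {u \<in> B. v \<rightarrow>\<^bsub>G\<^esub> u}))"
    (is "_ = ?E")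
  proof -
    have "(\<Sum>v\<in>V. a u v * h u * h v) = (if u \<in> B then real (card {w \<in> B. u \<rightarrow>\<^bsub>G\<^esub> w}) else 0)"
      for u
    proof -
      have "(\<Sum>v\<in>V. a u v * h v) = (\<Sum>v\<in>V. if v \<in> {w \<in> B. u \<rightarrow>\<^bsub>G\<^esub> w} then 1 else 0)"
        by (intro sum.cong) (auto simp: a_def h_def)
      also have "\<dots> = real (card (V \<inter> {w \<in> B. u \<rightarrow>\<^bsub>G\<^esub> w}))"
        using fin by (simp add: sum.If_cases)
      also have "V \<inter> {w \<in> B. u \<rightarrow>\<^bsub>G\<^esub> w} = {w \<in> B. u \<rightarrow>\<^bsub>G\<^esub> w}"
        using BV by auto
      finally show ?thesis by (auto simp: h_def)
    qed
    then show ?thesis using fin BV by (simp add: sum.If_cases)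
  qed
  have "(\<Sum>u\<in>V. \<Sum>v\<in>V. a u v * (h u - p) * (h v - p))
      = (\<Sum>u\<in>V. \<Sum>v\<in>V. a u v * h u * h v - p * (a u v * h u) - p * (a u v * h v) + p\<^sup>2 * a u v)"
    by (simp add: algebra_simps power2_eq_square)
  also have "\<dots> = ?E - p * (d * s) - p * (d * s) + p\<^sup>2 * (d * N)"
    by (simp only: sum.distrib sum_subtractf sum_distrib_left[symmetric]
        sum_hah sum_ah sum_ah' sum_a)
  also have "\<dots> = ?E - d * s * p"
    using N(2) by (simp add: p_def power2_eq_square field_simps)
  finally have form: "(\<Sum>u\<in>V. \<Sum>v\<in>V. a u v * (h u - p) * (h v - p)) = ?E - d * s * p" .
  have "(\<Sum>u\<in>V. (h u - p)\<^sup>2) = (\<Sum>u\<in>V. (1 - 2 * p) * h u + p\<^sup>2)"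
    by (intro sum.cong) (auto simp: h_def power2_eq_square algebra_simps)
  also have "\<dots> = (1 - 2 * p) * s + N * p\<^sup>2"
    using N by (simp add: sum.distrib sum_h flip: sum_distrib_left V_def)
  also have "\<dots> = s - s * p"
    using N(2) by (simp add: p_def power2_eq_square field_simps)
  finally have norm: "(\<Sum>u\<in>V. (h u - p)\<^sup>2) = s - s * p" .
  then have "0 \<le> s - s * p" by (metis sum_nonneg zero_le_power2)
  then have "- lam * (s - s * p) \<le> m * (s - s * p)" using lam by (intro mult_right_mono)
  also have "\<dots> \<le> ?E - d * s * p" using m[of "\<lambda>u. h u - p"] by (simp add: form norm)
  finally show ?thesis by (simp add: p_def s_def algebra_simps add_divide_distrib)
qed

section \<open>Counting stable sets by branching\<close>

definition stable_subsets :: "('a \<Rightarrow> 'a \<Rightarrow> bool) \<Rightarrow> 'a set \<Rightarrow> 'a set set" where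
  "stable_subsets E A = {S. S \<subseteq> A \<and> (\<forall>u\<in>S. \<forall>v\<in>S. \<not> E u v)}"

lemma finite_stable_subsets: "finite A \<Longrightarrow> finite (stable_subsets E A)"
  by (rule finite_subset[of _ "Pow A"]) (auto simp: stable_subsets_def)

lemma card_stable_subsets_branch:
  assumes "finite A"
  shows "card (stable_subsets E A) \<le> card (stable_subsets E (A - {v}))
    + card (stable_subsets E (A - {v} - {u. E v u}))"
proof -
  let ?T = "stable_subsets E (A - {v} - {u. E v u})"
  have "stable_subsets E A \<subseteq> stable_subsets E (A - {v}) \<union> insert v ` ?T"
  proof
    fix S assume S: "S \<in> stable_subsets E A"
    show "S \<in> stable_subsets E (A - {v}) \<union> insert v ` ?T"
    proof (cases "v \<in> S")
      case True
      then have "S - {v} \<in> ?T" using S by (auto simp: stable_subsets_def)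
      moreover have "S = insert v (S - {v})" using True by auto
      ultimately show ?thesis by blast
    next
      case False
      then show ?thesis using S by (auto simp: stable_subsets_def)
    qed
  qed
  then have "card (stable_subsets E A) \<le> card (stable_subsets E (A - {v}) \<union> insert v ` ?T)"
    using assms by (intro card_mono) (auto simp: finite_stable_subsets)
  also have "\<dots> \<le> card (stable_subsets E (A - {v})) + card (insert v ` ?T)"
    by (rule card_Un_le)
  also have "card (insert v ` ?T) \<le> card ?T"
    using assms by (intro card_image_le finite_stable_subsets) auto
  finally show ?thesis by simp
qed

lemma binomial_sum_pascal:
  "(\<Sum>i\<le>Suc k. Suc n choose i) = (\<Sum>i\<le>Suc k. n choose i) + (\<Sum>i\<le>k. n choose i)"
  by (simp add: sum.atMost_Suc_shift sum.distrib del: sum.atMost_Suc)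

text \<open>
  The hypothesis on \<open>k\<close> says that \<open>k\<close> branches containing the chosen vertex, each of which shrinks
  the potential \<open>\<beta> (|A| - c) + 1\<close> at least by the factor \<open>exp (-\<beta>)\<close>, bring it down to \<open>1\<close>, that is, bring
  \<open>|A|\<close> down to \<open>c\<close>. In this form it passes to both branches of the induction on \<open>|A|\<close>, whose
  bounds combine by Pascal's rule.
\<close>

lemma card_stable_subsets_le:
  fixes E :: "'a \<Rightarrow> 'a \<Rightarrow> bool" and \<beta> c :: real
  assumes "finite A" and beta: "\<beta> > 0" and irrefl: "\<And>v. \<not> E v v"
    and "\<And>B. B \<subseteq> A \<Longrightarrow> c < real (card B) \<Longrightarrow>
      \<exists>v\<in>B. \<beta> * (real (card B) - c) \<le> real (card {u \<in> B. E v u})"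
    and "\<beta> * (real (card A) - c) + 1 \<le> exp (\<beta> * real k)"
  shows "real (card (stable_subsets E A)) \<le> real (\<Sum>i\<le>k. card A choose i) * 2 powr c"
  using assms(1,4,5)
proof (induction "card A" arbitrary: A k rule: less_induct)
  case (less A k)
  note fin = \<open>finite A\<close> and deg = less.prems(2) and pot = less.prems(3)
  show ?case
  proof (cases "real (card A) \<le> c")
    case True
    have "card (stable_subsets E A) \<le> card (Pow A)"
      using fin by (intro card_mono) (auto simp: stable_subsets_def)
    then have "card (stable_subsets E A) \<le> 2 ^ card A"
      using fin by (simp add: card_Pow)
    then have "real (card (stable_subsets E A)) \<le> real (2 ^ card A)"
      by (rule of_nat_mono)
    also have "\<dots> = 2 powr real (card A)" by (simp add: powr_realpow)
    also have "\<dots> \<le> 2 powr c" using True by simp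
    also have "\<dots> \<le> real (\<Sum>i\<le>k. card A choose i) * 2 powr c"
    proof -
      have "card A choose 0 \<le> (\<Sum>i\<le>k. card A choose i)" by (rule member_le_sum) auto
      then have "1 \<le> real (\<Sum>i\<le>k. card A choose i)"
        by (simp del: of_nat_sum)
      then show ?thesis
        using mult_right_mono[of 1 _ "2 powr c"] by simp
    qed
    finally show ?thesis .
  next
    case False
    define x where "x = real (card A) - c"
    have x: "x > 0" using False by (simp add: x_def)
    obtain v where v: "v \<in> A" "\<beta> * x \<le> real (card {u \<in> A. E v u})"
      using deg[of A] False by (auto simp: x_def)
    have "k \<noteq> 0"
    proof
      assume "k = 0"
      then have "\<beta> * x \<le> 0" using pot by (simp add: x_def)
      then show False using beta x by (simp add: mult_le_0_iff)
    qed
    then obtain l where k: "k = Suc l" by (cases k) auto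
    obtain n where n: "card A = Suc n" using v fin by (cases "card A") auto
    let ?B = "A - {v}"
    let ?C = "A - {v} - {u. E v u}"
    have B: "card ?B = n" using v fin n by simp
    have CB: "card ?C \<le> n" using fin B by (metis Diff_subset card_mono finite_Diff)
    have "?C \<union> {u \<in> A. E v u} = ?B" "?C \<inter> {u \<in> A. E v u} = {}"
      using irrefl[of v] by auto
    then have "n = card ?C + card {u \<in> A. E v u}"
      using fin B card_Un_disjoint[of ?C "{u \<in> A. E v u}"] by simp
    then have C: "real (card ?C) - c \<le> x - 1 - \<beta> * x"
      using v(2) n by (simp add: x_def)
    have "real (card (stable_subsets E ?B)) \<le> real (\<Sum>i\<le>k. n choose i) * 2 powr c"
    proof -
      have "\<beta> * (real n - c) \<le> \<beta> * (real (card A) - c)" using beta n by simp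
      then have potB: "\<beta> * (real (card ?B) - c) + 1 \<le> exp (\<beta> * real k)"
        using pot unfolding B by linarith
      have "real (card (stable_subsets E ?B)) \<le> real (\<Sum>i\<le>k. card ?B choose i) * 2 powr c"
      proof (rule less.hyps[OF _ _ _ potB])
        show "card ?B < card A" using B n by simp
        show "finite ?B" using fin by simp
        show "\<exists>w\<in>B. \<beta> * (real (card B) - c) \<le> real (card {u \<in> B. E w u})"
          if "B \<subseteq> ?B" "c < real (card B)" for B
          by (rule deg[OF _ that(2)]) (use that(1) in auto)
      qed
      then show ?thesis unfolding B .
    qed
    moreover have "real (card (stable_subsets E ?C)) \<le> real (\<Sum>i\<le>l. n choose i) * 2 powr c"
    proof -
      have "\<beta> * (real (card ?C) - c) + 1 \<le> \<beta> * (x - 1 - \<beta> * x) + 1"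
        using mult_left_mono[OF C, of \<beta>] beta by linarith
      also have "\<dots> = (1 - \<beta>) * (\<beta> * x + 1)" by (simp add: algebra_simps)
      also have "\<dots> \<le> exp (- \<beta>) * (\<beta> * x + 1)"
        using exp_ge_add_one_self[of "- \<beta>"] beta x by (intro mult_right_mono) auto
      also have "\<dots> \<le> exp (- \<beta>) * exp (\<beta> * real k)"
        using pot by (intro mult_left_mono) (auto simp: x_def)
      also have "\<dots> = exp (\<beta> * real l)" by (simp add: k algebra_simps flip: exp_add)
      finally have potC: "\<beta> * (real (card ?C) - c) + 1 \<le> exp (\<beta> * real l)" .
      have "real (card (stable_subsets E ?C)) \<le> real (\<Sum>i\<le>l. card ?C choose i) * 2 powr c"
      proof (rule less.hyps[OF _ _ _ potC])
        show "card ?C < card A" using CB n by simp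
        show "finite ?C" using fin by simp
        show "\<exists>w\<in>B. \<beta> * (real (card B) - c) \<le> real (card {u \<in> B. E w u})"
          if "B \<subseteq> ?C" "c < real (card B)" for B
          by (rule deg[OF _ that(2)]) (use that(1) in auto)
      qed
      also have "\<dots> \<le> real (\<Sum>i\<le>l. n choose i) * 2 powr c"
        using CB by (intro mult_right_mono of_nat_mono sum_mono binomial_right_mono) auto
      finally show ?thesis .
    qed
    moreover have "real (card (stable_subsets E A))
        \<le> real (card (stable_subsets E ?B)) + real (card (stable_subsets E ?C))"
      using card_stable_subsets_branch[OF fin, of E v] by linarith
    ultimately have "real (card (stable_subsets E A))
        \<le> real ((\<Sum>i\<le>k. n choose i) + (\<Sum>i\<le>l. n choose i)) * 2 powr c"
      by (simp only: of_nat_add distrib_right)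
    then show ?thesis unfolding n k binomial_sum_pascal .
  qed
qed

section \<open>The bound on the number of stable sets\<close>

theorem theorem7:
  fixes G :: "('a, 'b) pre_digraph" and d N :: nat and lam alpha sigma :: real and vs :: "'a list"
  assumes "graph G" and "card (verts G) = N"
    and "regular_graph d G" and "d > 0"
    and "vertex_ordering G vs" and "smallest_eigenvalue (adjacency_matrix G vs) (- lam)"
    and "alpha = lam / (real d + lam)" and "sigma = ln (real d + 1) / (real d + lam)"
  shows "real (num_stable_sets G)
    \<le> (\<Sum>i = 0..nat \<lceil>sigma * real N\<rceil>. real (N choose i) * 2 powr (alpha * real N))"
proof -
  interpret graph G by fact
  define E where "E = (\<lambda>u v. u \<rightarrow>\<^bsub>G\<^esub> v)"
  define k where "k = nat \<lceil>sigma * real N\<rceil>"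
  have irrefl: "\<not> E v v" for v
    using no_loops by (auto simp: E_def arcs_ends_def arc_to_ends_def)
  have "N \<noteq> 0"
  proof
    \<comment> \<open>A matrix of size 0 has no eigenvalue.\<close>
    assume "N = 0"
    then have "vs = []" using assms(2,5) by (auto simp: vertex_ordering_def)
    moreover obtain w where "eigenvector (adjacency_matrix G vs) w (- lam)"
      using assms(6) by (auto simp: smallest_eigenvalue_def eigenvalue_def)
    ultimately show False by (auto simp: eigenvector_def adjacency_matrix_def)
  qed
  then have N: "real N > 0" by simp
  have avg: "real (card B) * ((real d + lam) * real (card B) / N - lam)
      \<le> (\<Sum>v\<in>B. real (card {u \<in> B. E v u}))" if "B \<subseteq> verts G" for B
    unfolding E_def using assms that N by (intro average_degree_ge) auto
  have lam: "lam \<ge> 0"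
  proof -
    \<comment> \<open>A single vertex spans no edge, so the bound reads \<open>d \<le> lam (N - 1)\<close>.\<close>
    obtain v where v: "v \<in> verts G" using assms(2) \<open>N \<noteq> 0\<close> by fastforce
    have none: "{u. u = v \<and> E v u} = {}" using irrefl by auto
    have "(real d + lam) / N - lam \<le> 0" using avg[of "{v}"] v by (simp add: none)
    then have "real d \<le> lam * (real N - 1)" using N by (simp add: field_simps)
    then have "0 < lam * (real N - 1)" using assms(4) by linarith
    then show ?thesis using N by (auto simp: zero_less_mult_iff)
  qed
  define \<beta> where "\<beta> = (real d + lam) / N"
  define c where "c = alpha * N"
  have dl: "real d + lam > 0" using lam assms(4) by simp
  then have beta: "\<beta> > 0" using N by (simp add: \<beta>_def)
  have "\<beta> * c = lam" using dl N by (simp add: \<beta>_def c_def assms(7))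
  then have beta_c: "\<beta> * (y - c) = (real d + lam) * y / N - lam" for y
    by (simp add: right_diff_distrib \<beta>_def)
  have "real (card (stable_subsets E (verts G))) \<le> real (\<Sum>i\<le>k. card (verts G) choose i) * 2 powr c"
  proof (rule card_stable_subsets_le[OF _ beta irrefl])
    \<comment> \<open>The maximum degree is at least the average degree.\<close>
    show "\<exists>v\<in>B. \<beta> * (real (card B) - c) \<le> real (card {u \<in> B. E v u})"
      if B: "B \<subseteq> verts G" "c < real (card B)" for B
    proof (rule ccontr)
      assume "\<not> ?thesis"
      then have small: "\<forall>v\<in>B. real (card {u \<in> B. E v u}) < \<beta> * (real (card B) - c)" by auto
      have "c \<ge> 0" using lam dl by (simp add: c_def assms(7))
      then have "finite B" "B \<noteq> {}" using B by (auto intro: finite_subset)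
      then have "(\<Sum>v\<in>B. real (card {u \<in> B. E v u})) < (\<Sum>v\<in>B. \<beta> * (real (card B) - c))"
        using small by (intro sum_strict_mono) auto
      also have "\<dots> = real (card B) * ((real d + lam) * real (card B) / N - lam)"
        by (simp add: beta_c)
      finally show False using avg[OF B(1)] by simp
    qed
    have "sigma * N \<le> real k" unfolding k_def by (rule real_nat_ceiling_ge)
    then have "ln (real d + 1) \<le> \<beta> * k"
      using dl N by (simp add: assms(8) \<beta>_def field_simps)
    then have "real d + 1 \<le> exp (\<beta> * k)"
      by (simp add: ln_le_cancel_iff[symmetric] ln_ge_iff)
    then show "\<beta> * (real (card (verts G)) - c) + 1 \<le> exp (\<beta> * k)"
      using N by (simp add: beta_c assms(2))
  qed simp
  moreover have "num_stable_sets G = card (stable_subsets E (verts G))"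
    by (simp add: num_stable_sets_def stable_set_def stable_subsets_def E_def)
  ultimately show ?thesis
    by (simp add: assms(2) k_def c_def sum_distrib_right atLeast0AtMost)
qed

end
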